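(* Let $T:V\to A$ be a relative Rota-Baxter operator on an averaging pre-Lie algebra $((A,\circ),P)$ with respect to a representation $((V,\rho,\varphi),\alpha)$. Let $\circ_T$ be the product on $V$ given by $u\circ_Tv=\rho(Tu)v+\varphi(Tv)u$, and define $\rho',\varphi':V\to\mathrm{End}(A)$ by $$\rho'(u)x=-T(\varphi(x)u)+Tu\circ x,\qquad \varphi'(u)x=-T(\rho(x)u)+x\circ Tu,\qquad u\in V,\ x\in A.$$ Then $\bigl(((A,\circ),P),((V,\circ_T),\alpha),\rho,\varphi,\rho',\varphi'\bigr)$ is a matched pair of averaging pre-Lie algebras.
   Context: All vector spaces are finite-dimensional over a fixed field $\mathbf k$ of characteristic $0$. A pre-Lie algebra $(A,\circ)$ is a vector space with a bilinear product satisfying $(x\circ y)\circ z-x\circ(y\circ z)=(y\circ x)\circ z-y\circ(x\circ z)$. An averaging operator is a linear $P:A\to A$ with $P(x)\circ P(y)=P(P(x)\circ y)=P(x\circ P(y))$; then $((A,\circ),P)$ is an averaging pre-Lie algebra. A representation of $(A,\circ)$ is $(V,\rho,\varphi)$ with linear $\rho,\varphi:A\to\mathrm{End}(V)$ such that $\rho(x\circ y-y\circ x)=\rho(x)\rho(y)-\rho(y)\rho(x)$ and $\varphi(x\circ y)=\rho(x)\varphi(y)-\varphi(y)\rho(x)+\varphi(y)\varphi(x)$. A representation of $((A,\circ),P)$ is $((V,\rho,\varphi),\alpha)$ with $(V,\rho,\varphi)$ a representation of $(A,\circ)$ and $\alpha:V\to V$ linear such that $\rho(P(x))\alpha(v)=\alpha(\rho(P(x))v)=\alpha(\rho(x)\alpha(v))$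 and $\varphi(P(x))\alpha(v)=\alpha(\varphi(P(x))v)=\alpha(\varphi(x)\alpha(v))$. A relative Rota-Baxter operator on $((A,\circ),P)$ with respect to $((V,\rho,\varphi),\alpha)$ is a linear map $T:V\to A$ with $T(u)\circ T(v)=T(\rho(T(u))v+\varphi(T(v))u)$ for all $u,v\in V$ and $P\circ T=T\circ\alpha$. The pair $((V,\circ_T),\alpha)$ is called the descendent averaging pre-Lie algebra. A matched pair of averaging pre-Lie algebras is a sextuple $(((A,\circ_A),P_A),((\mathfrak b,\circ_{\mathfrak b}),P_{\mathfrak b}),\rho_A,\varphi_A,\rho_{\mathfrak b},\varphi_{\mathfrak b})$ where the first two entries are averaging pre-Lie algebras, $((\mathfrak b,\rho_A,\varphi_A),P_{\mathfrak b})$ is a representation of $((A,\circ_A),P_A)$, $((A,\rho_{\mathfrak b},\varphi_{\mathfrak b}),P_A)$ is a representation of $((\mathfrak b,\circ_{\mathfrak b}),P_{\mathfrak b})$, and for all $x,y\in A$, $a,b\in\mathfrak b$: $\rho_A(x)(a\circ_{\mathfrak b}b)=-\rho_A(\rho_{\mathfrak b}(a)x-\varphi_{\mathfrak b}(a)x)b+(\rho_A(x)a-\varphi_A(x)a)\circ_{\mathfrak b}b+\varphi_A(\varphi_{\mathfrak b}(b)x)a+a\circ_{\mathfrak b}(\rho_A(x)b)$, $\varphi_A(x)(a\circ_{\mathfrak b}b-b\circ_{\mathfrak b}a)=\varphi_A(\rho_{\mathfrak b}(b)x)a-\varphi_A(\rho_{\mathfrak b}(a)x)b+a\circ_{\mathfrak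 b}(\varphi_A(x)b)-b\circ_{\mathfrak b}(\varphi_A(x)a)$, $\rho_{\mathfrak b}(a)(x\circ_Ay)=-\rho_{\mathfrak b}(\rho_A(x)a-\varphi_A(x)a)y+(\rho_{\mathfrak b}(a)x-\varphi_{\mathfrak b}(a)x)\circ_Ay+\varphi_{\mathfrak b}(\varphi_A(y)a)x+x\circ_A(\rho_{\mathfrak b}(a)y)$, $\varphi_{\mathfrak b}(a)(x\circ_Ay-y\circ_Ax)=\varphi_{\mathfrak b}(\rho_A(y)a)x-\varphi_{\mathfrak b}(\rho_A(x)a)y+x\circ_A(\varphi_{\mathfrak b}(a)y)-y\circ_A(\varphi_{\mathfrak b}(a)x)$. *)

theory Defs
  imports Complex_Main
begin

text \<open>
  A vector space over the field \<open>'k\<close> is given by the library locale \<open>vector_space\<close>: a type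
  together with a scalar multiplication. Its finite dimensionality is the existence of a
  finite basis, so that no basis is part of the structures below.
\<close>

locale fin_dim_space = vector_space scale
  for scale :: "'k::field_char_0 \<Rightarrow> 'v::ab_group_add \<Rightarrow> 'v" +
  assumes fin_dim: "\<exists>Basis. finite_dimensional_vector_space scale Basis"

text \<open>
  Bilinearity over an arbitrary field (the library constant \<open>bilinear\<close> is restricted to the
  reals). Curried, a bilinear \<open>f\<close> is the same thing as a linear map into the space of linear
  maps; in particular a linear map \<open>A \<rightarrow> End(V)\<close> is a bilinear \<open>A \<times> V \<rightarrow> V\<close>.
\<close>

definition bilinear_map ::
  "('k::field \<Rightarrow> 'a::ab_group_add \<Rightarrow> 'a) \<Rightarrow> ('k \<Rightarrow> 'b::ab_group_add \<Rightarrow> 'b) \<Rightarrow>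
   ('k \<Rightarrow> 'c::ab_group_add \<Rightarrow> 'c) \<Rightarrow> ('a \<Rightarrow> 'b \<Rightarrow> 'c) \<Rightarrow> bool" where
  "bilinear_map sA sB sC f \<longleftrightarrow>
     (\<forall>x. Vector_Spaces.linear sB sC (f x)) \<and>
     (\<forall>y. Vector_Spaces.linear sA sC (\<lambda>x. f x y))"

locale pre_lie_algebra = fin_dim_space sA
  for sA :: "'k::field_char_0 \<Rightarrow> 'a::ab_group_add \<Rightarrow> 'a" +
  fixes mult :: "'a \<Rightarrow> 'a \<Rightarrow> 'a"  (infixl "\<odot>" 70)
  assumes mult_bilinear: "bilinear_map sA sA sA mult"
    and pre_lie: "(x \<odot> y) \<odot> z - x \<odot> (y \<odot> z) = (y \<odot> x) \<odot> z - y \<odot> (x \<odot> z)"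

locale averaging_pre_lie_algebra = pre_lie_algebra sA mult
  for sA :: "'k::field_char_0 \<Rightarrow> 'a::ab_group_add \<Rightarrow> 'a"
    and mult :: "'a \<Rightarrow> 'a \<Rightarrow> 'a"  (infixl "\<odot>" 70) +
  fixes P :: "'a \<Rightarrow> 'a"
  assumes P_linear: "Vector_Spaces.linear sA sA P"
    and averaging_left: "P x \<odot> P y = P (P x \<odot> y)"
    and averaging_right: "P x \<odot> P y = P (x \<odot> P y)"

locale pre_lie_representation = pre_lie_algebra sA mult + V: fin_dim_space sV
  for sA :: "'k::field_char_0 \<Rightarrow> 'a::ab_group_add \<Rightarrow> 'a"
    and mult :: "'a \<Rightarrow> 'a \<Rightarrow> 'a"  (infixl "\<odot>" 70)
    and sV :: "'k \<Rightarrow> 'v::ab_group_add \<Rightarrow> 'v" +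
  fixes \<rho> \<phi> :: "'a \<Rightarrow> 'v \<Rightarrow> 'v"
  assumes rho_linear: "bilinear_map sA sV sV \<rho>"
    and phi_linear: "bilinear_map sA sV sV \<phi>"
    and rho_rep: "\<rho> (x \<odot> y - y \<odot> x) v = \<rho> x (\<rho> y v) - \<rho> y (\<rho> x v)"
    and phi_rep: "\<phi> (x \<odot> y) v = \<rho> x (\<phi> y v) - \<phi> y (\<rho> x v) + \<phi> y (\<phi> x v)"

locale averaging_representation =
  averaging_pre_lie_algebra sA mult P + pre_lie_representation sA mult sV \<rho> \<phi>
  for sA :: "'k::field_char_0 \<Rightarrow> 'a::ab_group_add \<Rightarrow> 'a"
    and mult :: "'a \<Rightarrow> 'a \<Rightarrow> 'a"  (infixl "\<odot>" 70)
    and P :: "'a \<Rightarrow> 'a"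
    and sV :: "'k \<Rightarrow> 'v::ab_group_add \<Rightarrow> 'v"
    and \<rho> \<phi> :: "'a \<Rightarrow> 'v \<Rightarrow> 'v" +
  fixes \<alpha> :: "'v \<Rightarrow> 'v"
  assumes alpha_linear: "Vector_Spaces.linear sV sV \<alpha>"
    and rho_alpha_left: "\<rho> (P x) (\<alpha> v) = \<alpha> (\<rho> (P x) v)"
    and rho_alpha_right: "\<alpha> (\<rho> (P x) v) = \<alpha> (\<rho> x (\<alpha> v))"
    and phi_alpha_left: "\<phi> (P x) (\<alpha> v) = \<alpha> (\<phi> (P x) v)"
    and phi_alpha_right: "\<alpha> (\<phi> (P x) v) = \<alpha> (\<phi> x (\<alpha> v))"

locale relative_Rota_Baxter_operator = averaging_representation sA mult P sV \<rho> \<phi> \<alpha>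
  for sA :: "'k::field_char_0 \<Rightarrow> 'a::ab_group_add \<Rightarrow> 'a"
    and mult :: "'a \<Rightarrow> 'a \<Rightarrow> 'a"  (infixl "\<odot>" 70)
    and P :: "'a \<Rightarrow> 'a"
    and sV :: "'k \<Rightarrow> 'v::ab_group_add \<Rightarrow> 'v"
    and \<rho> \<phi> :: "'a \<Rightarrow> 'v \<Rightarrow> 'v"
    and \<alpha> :: "'v \<Rightarrow> 'v" +
  fixes T :: "'v \<Rightarrow> 'a"
  assumes T_linear: "Vector_Spaces.linear sV sA T"
    and Rota_Baxter: "T u \<odot> T v = T (\<rho> (T u) v + \<phi> (T v) u)"
    and T_alpha: "P \<circ> T = T \<circ> \<alpha>"

locale matched_pair_averaging_pre_lie =
  A: averaging_pre_lie_algebra sA multA PA +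
  B: averaging_pre_lie_algebra sB multB PB +
  repA: averaging_representation sA multA PA sB \<rho>A \<phi>A PB +
  repB: averaging_representation sB multB PB sA \<rho>B \<phi>B PA
  for sA :: "'k::field_char_0 \<Rightarrow> 'a::ab_group_add \<Rightarrow> 'a"
    and multA :: "'a \<Rightarrow> 'a \<Rightarrow> 'a"  (infixl "\<odot>\<^sub>A" 70)
    and PA :: "'a \<Rightarrow> 'a"
    and sB :: "'k \<Rightarrow> 'b::ab_group_add \<Rightarrow> 'b"
    and multB :: "'b \<Rightarrow> 'b \<Rightarrow> 'b"  (infixl "\<odot>\<^sub>B" 70)
    and PB :: "'b \<Rightarrow> 'b"
    and \<rho>A \<phi>A :: "'a \<Rightarrow> 'b \<Rightarrow> 'b"
    and \<rho>B \<phi>B :: "'b \<Rightarrow> 'a \<Rightarrow> 'a" +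
  assumes rhoA_mult:
      "\<rho>A x (a \<odot>\<^sub>B b) =
        - \<rho>A (\<rho>B a x - \<phi>B a x) b + (\<rho>A x a - \<phi>A x a) \<odot>\<^sub>B b + \<phi>A (\<phi>B b x) a + a \<odot>\<^sub>B \<rho>A x b"
    and phiA_commutator:
      "\<phi>A x (a \<odot>\<^sub>B b - b \<odot>\<^sub>B a) =
        \<phi>A (\<rho>B b x) a - \<phi>A (\<rho>B a x) b + a \<odot>\<^sub>B \<phi>A x b - b \<odot>\<^sub>B \<phi>A x a"
    and rhoB_mult:
      "\<rho>B a (x \<odot>\<^sub>A y) =
        - \<rho>B (\<rho>A x a - \<phi>A x a) y + (\<rho>B a x - \<phi>B a x) \<odot>\<^sub>A y + \<phi>B (\<phi>A y a) x + x \<odot>\<^sub>A \<rho>B a y"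
    and phiB_commutator:
      "\<phi>B a (x \<odot>\<^sub>A y - y \<odot>\<^sub>A x) =
        \<phi>B (\<rho>A y a) x - \<phi>B (\<rho>A x a) y + x \<odot>\<^sub>A \<phi>B a y - y \<odot>\<^sub>A \<phi>B a x"

end

theory Submission
  imports Defs
begin

text \<open>In the semidirect product of A and V, with (x,u)(y,v) = (x \<odot> y, \<rho> x v +
  \<phi> y u), the Rota-Baxter identity says that the graph of \<open>T\<close>, the set of all (T
  u, u), is a subalgebra; projected to V, its product is the descendent one. The graph is a
  complement of A, so this pre-Lie algebra splits into two subalgebras, which is what a matched pair
  encodes. As P T = T \<alpha>, the averaging operator (P, \<alpha>) preserves both summands. The
  resulting axioms are checked directly by expansion: \<open>desc_averaging_pre_lie_algebra\<close>
  covers V, \<open>desc_averaging_representation\<close> its action on A, and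
  \<open>desc_matched_pair\<close> the compatibility.\<close>

lemma linear_map_simps:
  assumes "Vector_Spaces.linear sA sB f"
  shows "f (x + y) = f x + f y" "f (x - y) = f x - f y" "f (- x) = - f x" "f (sA c x) = sB c (f x)"
proof -
  interpret f: module_hom sA sB f
    using assms by (simp add: linear_iff_module_hom)
  show "f (x + y) = f x + f y" "f (x - y) = f x - f y" "f (- x) = - f x" "f (sA c x) = sB c (f x)"
    by (rule f.add f.diff f.neg f.scale)+
qed

lemma bilinear_map_simps:
  assumes "bilinear_map sA sB sC f"
  shows "f (x + x') y = f x y + f x' y" "f (x - x') y = f x y - f x' y" "f (- x) y = - f x y"
    and "f (sA c x) y = sC c (f x y)"
    and "f x (y + y') = f x y + f x y'" "f x (y - y') = f x y - f x y'" "f x (- y) = - f x y"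
    and "f x (sB c y) = sC c (f x y)"
proof -
  have l: "Vector_Spaces.linear sA sC (\<lambda>x. f x y)" for y
    using assms by (simp add: bilinear_map_def)
  have r: "Vector_Spaces.linear sB sC (f x)" for x
    using assms by (simp add: bilinear_map_def)
  show "f (x + x') y = f x y + f x' y" "f (x - x') y = f x y - f x' y" "f (- x) y = - f x y"
    "f (sA c x) y = sC c (f x y)"
    "f x (y + y') = f x y + f x y'" "f x (y - y') = f x y - f x y'" "f x (- y) = - f x y"
    "f x (sB c y) = sC c (f x y)"
    by (rule linear_map_simps[OF l] linear_map_simps[OF r])+
qed

lemma linearI:
  assumes "vector_space sA" "vector_space sB"
    and "\<And>x y. f (x + y) = f x + f y" "\<And>c x. f (sA c x) = sB c (f x)"
  shows "Vector_Spaces.linear sA sB f"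
  using assms
  by (simp add: Vector_Spaces.linear_def module_hom_def module_hom_axioms_def
      module_iff_vector_space)

context relative_Rota_Baxter_operator
begin

lemmas hom_simps =
  bilinear_map_simps[OF mult_bilinear] bilinear_map_simps[OF rho_linear]
  bilinear_map_simps[OF phi_linear] linear_map_simps[OF T_linear]
  linear_map_simps[OF alpha_linear] linear_map_simps[OF P_linear]
  scale_right_distrib V.scale_right_distrib
  scale_right_diff_distrib V.scale_right_diff_distrib
  scale_minus_right V.scale_minus_right

definition desc_mult :: "'v \<Rightarrow> 'v \<Rightarrow> 'v"  (infixl "\<odot>\<^sub>T" 70) where
  "u \<odot>\<^sub>T v = \<rho> (T u) v + \<phi> (T v) u"

text \<open>Along the splitting into A and the graph of \<open>T\<close>, (T u, u)(x, 0) has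
  A-component \<open>rhoT u x\<close> and graph part over \<open>\<phi> x u\<close>; (x, 0)(T u, u)
  has A-component \<open>phiT u x\<close> and graph part over \<open>\<rho> x u\<close>.\<close>

definition rhoT :: "'v \<Rightarrow> 'a \<Rightarrow> 'a" where
  "rhoT u x = - T (\<phi> x u) + T u \<odot> x"

definition phiT :: "'v \<Rightarrow> 'a \<Rightarrow> 'a" where
  "phiT u x = - T (\<rho> x u) + x \<odot> T u"

lemmas T_defs = desc_mult_def rhoT_def phiT_def

lemma T_desc_mult: "T (u \<odot>\<^sub>T v) = T u \<odot> T v"
  by (simp add: desc_mult_def Rota_Baxter)

lemma T_\<alpha>: "T (\<alpha> u) = P (T u)"
  using T_alpha by (metis comp_apply)

text \<open>Solved form of \<open>rho_rep\<close>, usable after linearity has split the commutator.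
  As a free rewrite rule it would keep swapping the factors, so each use fixes both.\<close>

lemma rho_commutator: "\<rho> (x \<odot> y) v = \<rho> (y \<odot> x) v + \<rho> x (\<rho> y v) - \<rho> y (\<rho> x v)"
  using rho_rep[of x y v] by (simp add: hom_simps algebra_simps)

lemma desc_pre_lie_algebra: "pre_lie_algebra sV (\<odot>\<^sub>T)"
proof unfold_locales
  show "bilinear_map sV sV sV (\<odot>\<^sub>T)"
    unfolding bilinear_map_def
    by (auto intro!: linearI simp: desc_mult_def hom_simps V.vector_space_axioms)
  show "(u \<odot>\<^sub>T v) \<odot>\<^sub>T w - u \<odot>\<^sub>T (v \<odot>\<^sub>T w) = (v \<odot>\<^sub>T u) \<odot>\<^sub>T w - v \<odot>\<^sub>T (u \<odot>\<^sub>T w)" for u v w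
    \<comment> \<open>Only the outer products are opened, so that \<open>T\<close> still meets the
      inner ones whole and \<open>T_desc_mult\<close> applies. By \<open>phi_rep\<close>, the rest
      of the associator is symmetric in u and v up to the commutator rule for
      \<open>\<rho>\<close>.\<close>
    unfolding desc_mult_def[of "u \<odot>\<^sub>T v"] desc_mult_def[of "v \<odot>\<^sub>T u"]
      desc_mult_def[of u "v \<odot>\<^sub>T w"] desc_mult_def[of v "u \<odot>\<^sub>T w"] T_desc_mult
    by (simp add: desc_mult_def hom_simps phi_rep rho_commutator[of "T u" "T v"] algebra_simps)
qed

lemma desc_averaging_pre_lie_algebra: "averaging_pre_lie_algebra sV (\<odot>\<^sub>T) \<alpha>"
proof (intro averaging_pre_lie_algebra.intro averaging_pre_lie_algebra_axioms.intro
    desc_pre_lie_algebra)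
  show "Vector_Spaces.linear sV sV \<alpha>"
    by (fact alpha_linear)
  show "\<alpha> u \<odot>\<^sub>T \<alpha> v = \<alpha> (\<alpha> u \<odot>\<^sub>T v)" "\<alpha> u \<odot>\<^sub>T \<alpha> v = \<alpha> (u \<odot>\<^sub>T \<alpha> v)" for u v
    by (simp_all add: desc_mult_def hom_simps T_\<alpha> rho_alpha_left phi_alpha_left
        rho_alpha_right phi_alpha_right)
qed

text \<open>\<open>Rota_Baxter\<close> turns products of two values of \<open>T\<close> into values
  of \<open>T\<close>; nested terms such as \<open>T (\<phi> (T (\<phi> x v)) u)\<close> then
  cancel. What remains is the pre-Lie identity of A and images under \<open>T\<close> of
  representation identities.\<close>

lemma desc_pre_lie_representation: "pre_lie_representation sV (\<odot>\<^sub>T) sA rhoT phiT"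
proof (intro pre_lie_representation.intro desc_pre_lie_algebra, unfold_locales)
  show "bilinear_map sV sA sA rhoT" "bilinear_map sV sA sA phiT"
    unfolding bilinear_map_def
    by (auto intro!: linearI simp: T_defs hom_simps V.vector_space_axioms vector_space_axioms)
  show "rhoT (u \<odot>\<^sub>T v - v \<odot>\<^sub>T u) x = rhoT u (rhoT v x) - rhoT v (rhoT u x)" for u v x
    using pre_lie[of "T u" "T v" x]
    by (simp add: T_defs hom_simps phi_rep Rota_Baxter algebra_simps)
  show "phiT (u \<odot>\<^sub>T v) x = rhoT u (phiT v x) - phiT v (rhoT u x) + phiT v (phiT u x)" for u v x
    \<comment> \<open>The commutator of \<open>\<rho>\<close> enters under \<open>T\<close>, through
      \<open>phiT v (rhoT u x)\<close> and \<open>phiT v (phiT u x)\<close>.\<close>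
    using pre_lie[of "T u" x "T v"] arg_cong[OF rho_commutator[of "T u" x v], of T]
    by (simp add: T_defs hom_simps phi_rep Rota_Baxter algebra_simps)
qed

lemma desc_averaging_representation: "averaging_representation sV (\<odot>\<^sub>T) \<alpha> sA rhoT phiT P"
proof (intro averaging_representation.intro averaging_representation_axioms.intro
    desc_averaging_pre_lie_algebra desc_pre_lie_representation)
  show "Vector_Spaces.linear sA sA P"
    by (fact P_linear)
  note avg = rho_alpha_left phi_alpha_left rho_alpha_right phi_alpha_right
  have P_T: "P (T u) = T (\<alpha> u)" for u
    by (simp add: T_\<alpha>)
  \<comment> \<open>\<open>P_T\<close> pushes \<open>P\<close> inside \<open>T\<close>, so the
    averaging identities are restated with \<open>T (\<alpha> u)\<close> in place of
    \<open>P (T u)\<close>.\<close>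
  have avgP: "T (\<alpha> u) \<odot> P x = P (T (\<alpha> u) \<odot> x)" "P (T (\<alpha> u) \<odot> x) = P (T u \<odot> P x)"
    "P x \<odot> T (\<alpha> u) = P (x \<odot> T (\<alpha> u))" "P (P x \<odot> T u) = P (x \<odot> T (\<alpha> u))" for u x
    by (metis T_\<alpha> averaging_left averaging_right)+
  show "rhoT (\<alpha> u) (P x) = P (rhoT (\<alpha> u) x)" "P (rhoT (\<alpha> u) x) = P (rhoT u (P x))"
    "phiT (\<alpha> u) (P x) = P (phiT (\<alpha> u) x)" "P (phiT (\<alpha> u) x) = P (phiT u (P x))" for u x
    by (simp_all add: T_defs hom_simps P_T avg avgP)
qed

text \<open>In each compatibility identity the terms in which a value of \<open>T\<close> at
  \<open>\<rho> x a\<close>, \<open>\<phi> x a\<close> or the like acts or is a factor cancel in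
  pairs. The V-valued remainders are representation identities; the A-valued ones combine the
  pre-Lie identity for x, y, \<open>T a\<close> with the image under \<open>T\<close> of a
  representation identity.\<close>

lemma desc_matched_pair:
  "matched_pair_averaging_pre_lie sA (\<odot>) P sV (\<odot>\<^sub>T) \<alpha> \<rho> \<phi> rhoT phiT"
proof (intro matched_pair_averaging_pre_lie.intro averaging_pre_lie_algebra_axioms
    desc_averaging_pre_lie_algebra averaging_representation_axioms
    desc_averaging_representation, unfold_locales)
  fix x y :: 'a and a b :: 'v
  show "\<rho> x (a \<odot>\<^sub>T b) = - \<rho> (rhoT a x - phiT a x) b + (\<rho> x a - \<phi> x a) \<odot>\<^sub>T b
      + \<phi> (phiT b x) a + a \<odot>\<^sub>T \<rho> x b"
    by (simp add: T_defs hom_simps phi_rep rho_commutator[of x "T a"] algebra_simps)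
  show "\<phi> x (a \<odot>\<^sub>T b - b \<odot>\<^sub>T a) = \<phi> (rhoT b x) a - \<phi> (rhoT a x) b
      + a \<odot>\<^sub>T \<phi> x b - b \<odot>\<^sub>T \<phi> x a"
    by (simp add: T_defs hom_simps phi_rep algebra_simps)
  show "rhoT a (x \<odot> y) = - rhoT (\<rho> x a - \<phi> x a) y + (rhoT a x - phiT a x) \<odot> y
      + phiT (\<phi> y a) x + x \<odot> rhoT a y"
    using pre_lie[of "T a" x y]
    by (simp add: T_defs hom_simps phi_rep algebra_simps)
  show "phiT a (x \<odot> y - y \<odot> x) = phiT (\<rho> y a) x - phiT (\<rho> x a) y
      + x \<odot> phiT a y - y \<odot> phiT a x"
    using pre_lie[of x y "T a"]
    by (simp add: T_defs hom_simps rho_commutator[of x y] algebra_simps)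
qed

end

theorem proposition4p10:
  fixes sA :: "'k::field_char_0 \<Rightarrow> 'a::ab_group_add \<Rightarrow> 'a"
    and mult :: "'a \<Rightarrow> 'a \<Rightarrow> 'a"  (infixl "\<odot>" 70)
    and P :: "'a \<Rightarrow> 'a"
    and sV :: "'k \<Rightarrow> 'v::ab_group_add \<Rightarrow> 'v"
    and \<rho> \<phi> :: "'a \<Rightarrow> 'v \<Rightarrow> 'v"
    and \<alpha> :: "'v \<Rightarrow> 'v"
    and T :: "'v \<Rightarrow> 'a"
  assumes "relative_Rota_Baxter_operator sA (\<odot>) P sV \<rho> \<phi> \<alpha> T"
  shows "matched_pair_averaging_pre_lie
           sA (\<odot>) P
           sV (\<lambda>u v. \<rho> (T u) v + \<phi> (T v) u) \<alpha>
           \<rho> \<phi>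
           (\<lambda>u x. - T (\<phi> x u) + T u \<odot> x)
           (\<lambda>u x. - T (\<rho> x u) + x \<odot> T u)"
proof -
  interpret relative_Rota_Baxter_operator sA "(\<odot>)" P sV \<rho> \<phi> \<alpha> T
    by (fact assms)
  show ?thesis
    using desc_matched_pair unfolding desc_mult_def[abs_def] rhoT_def[abs_def] phiT_def[abs_def] .
qed

end
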